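(* Let $\mathbf T$ be an operator and $f$ a function such that $\mathbf Tf$ is a measurable function on $\mathbb{R}^n$. Assume that there exist $R_0\ge1$ and $G_f\in L^1(\mathbb S^{n-1})$ such that $$r^n|\mathbf Tf(r\theta)|\le G_f(\theta)\qquad\text{for all }r\ge R_0\text{ and a.e. }\theta\in\mathbb S^{n-1},$$ and that the limit $$A_f(\theta):=\lim_{r\to\infty}r^n|\mathbf Tf(r\theta)|$$ exists for almost every $\theta\in\mathbb S^{n-1}$. Assume moreover that there is $p_0>1$ such that $\mathbf Tf\in L^{p_0}(B(0,1))$, $G_f\in L^{p_0}(\mathbb S^{n-1})$, and $$\lim_{R\to\infty}\sup_{r\ge R}\bigl\|r^n|\mathbf Tf(r\,\cdot)|-A_f\bigr\|_{L^{p_0}(\mathbb S^{n-1})}=0.$$ Then $$\lim_{p\to1^+}(p-1)\|\mathbf Tf\|_{L^p(\mathbb{R}^n)}^p=\frac1n\int_{\mathbb S^{n-1}}A_f(\theta)\,d\theta.$$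
   Context: $d\theta$ is surface measure on the unit sphere $\mathbb S^{n-1}\subset\mathbb{R}^n$, and $B(0,1)$ is the unit ball of $\mathbb{R}^n$ centered at the origin.
   Formalization: The formal theorem additionally assumes that Tf is in L^{p_0} on the annulus B(0,R_0) \ B(0,1); without this the claim fails when R_0 > 1, since Tf may be non-integrable there. For R_0 = 1 nothing is added. *)

theory Defs
  imports "HOL-Analysis.Analysis"
begin

(* Surface measure on the unit sphere as the cone measure: with N the dimension, the mass of E
   is N times the Lebesgue measure of {r *R \<theta> | 0 < r < 1, \<theta> \<in> E}.  This is the measure occurring in
   polar coordinates dx = r^(N-1) dr d\<theta>; in dimension one it is counting measure on {-1, 1}.
   The completion makes functions that are specified only almost everywhere measurable. *)
definition surface_measure :: "'a::euclidean_space measure" where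
  "surface_measure = completion
     (distr (scale_measure (of_nat DIM('a)) (restrict_space lborel (ball 0 1 - {0})))
            (restrict_space borel (sphere 0 1))
            (\<lambda>x. x /\<^sub>R norm x))"

lemma space_surface_measure [simp]: "space surface_measure = sphere (0::'a::euclidean_space) 1"
  by (simp add: surface_measure_def)

lemma emeasure_surface_measure:
  fixes E :: "'a::euclidean_space set"
  assumes "E \<in> sets borel" "E \<subseteq> sphere 0 1"
  shows "emeasure surface_measure E =
    of_nat DIM('a) * emeasure lborel {x \<in> ball 0 1 - {0}. x /\<^sub>R norm x \<in> E}"
proof -
  let ?C = "ball 0 1 - {0::'a}"
  let ?L = "scale_measure (of_nat DIM('a)) (restrict_space lborel ?C)"
  let ?S = "restrict_space borel (sphere (0::'a) 1)"
  have C: "?C \<in> sets lborel" by simp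
  have m: "(\<lambda>x. x /\<^sub>R norm x) \<in> measurable ?L ?S"
  proof (rule measurable_restrict_space2)
    show "(\<lambda>x. x /\<^sub>R norm x) \<in> space ?L \<rightarrow> sphere 0 1"
      by (auto simp: space_scale_measure space_restrict_space)
    have "(\<lambda>x::'a. x /\<^sub>R norm x) \<in> borel_measurable (restrict_space lborel ?C)"
      by (rule measurable_restrict_space1) measurable
    then show "(\<lambda>x. x /\<^sub>R norm x) \<in> borel_measurable ?L"
      by (simp add: measurable_def space_scale_measure)
  qed
  have E: "E \<in> sets ?S"
    using assms by (auto simp: sets_restrict_space_iff)
  have eq: "(\<lambda>x. x /\<^sub>R norm x) -` E \<inter> space ?L = {x \<in> ?C. x /\<^sub>R norm x \<in> E}"
    by (auto simp: space_scale_measure space_restrict_space)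
  have "emeasure surface_measure E = emeasure (distr ?L ?S (\<lambda>x. x /\<^sub>R norm x)) E"
    unfolding surface_measure_def using E by (simp add: main_part_sets emeasure_completion)
  also have "\<dots> = emeasure ?L {x \<in> ?C. x /\<^sub>R norm x \<in> E}"
    using emeasure_distr[OF m E] eq by simp
  also have "\<dots> = of_nat DIM('a) * emeasure lborel {x \<in> ?C. x /\<^sub>R norm x \<in> E}"
    using C by (subst emeasure_scale_measure, subst emeasure_restrict_space) auto
  finally show ?thesis .
qed

(* Powers with a positive real exponent, with \<infinity> powr a = \<infinity>. *)
definition ennreal_powr :: "ennreal \<Rightarrow> real \<Rightarrow> ennreal" where
  "ennreal_powr x a = (if x = \<infinity> then \<infinity> else ennreal (enn2real x powr a))"

(* The L^p norm for 0 < p < \<infinity>, with value \<infinity> for measurable functions outside L^p. *)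
definition Lp_norm :: "real \<Rightarrow> 'a measure \<Rightarrow> ('a \<Rightarrow> 'b::real_normed_vector) \<Rightarrow> ennreal" where
  "Lp_norm p M g = ennreal_powr (\<integral>\<^sup>+ x. ennreal (norm (g x) powr p) \<partial>M) (1 / p)"

definition in_Lp :: "real \<Rightarrow> 'a measure \<Rightarrow> ('a \<Rightarrow> 'b::real_normed_vector) \<Rightarrow> bool" where
  "in_Lp p M g \<longleftrightarrow> g \<in> borel_measurable M \<and> Lp_norm p M g < \<infinity>"

end

theory Submission
  imports Defs
begin

text \<open>
  The part of the integral over a ball is bounded uniformly in \<open>p\<close> near 1, hence is killed by the
  factor \<open>p - 1\<close>. Outside the ball, write \<open>N\<close> for the dimension, use polar coordinates and substitute
  \<open>u = r powr (- N (p - 1))\<close>: this turns \<open>(p - 1) |x| powr (- N p) dx\<close> into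
  \<open>(1 / N) du d\<theta>\<close>, so that
  \<open>(p - 1) \<integral> |F|^p dx = (1 / N) \<integral>\<integral> (r^N |F (r \<theta>)|)^p du d\<theta>\<close> with \<open>r = u powr (- 1 / (N (p - 1)))\<close>.
  For fixed \<open>0 < u < 1\<close> the radius \<open>r\<close> tends to infinity as \<open>p\<close> tends to 1, so the integrand tends to
  \<open>A \<theta>\<close>, and dominated convergence on \<open>(0,1) \<times> sphere\<close> with majorant \<open>1 + |G| powr p0\<close> applies.
\<close>

section \<open>Lebesgue measure on the positive half-line and the power substitution\<close>

text \<open>A density is used instead of a restricted space so that the sigma-algebra stays
  \<open>borel\<close> on the whole line: measures on it can then be compared directly with image
  measures on \<open>borel\<close>.\<close>

abbreviation lborel_pos :: "real measure" where
  "lborel_pos \<equiv> density lborel (indicator {0<..})"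

lemma nn_integral_lborel_pos:
  assumes [measurable]: "f \<in> borel_measurable borel"
  shows "(\<integral>\<^sup>+ x. f x \<partial>lborel_pos) = (\<integral>\<^sup>+ x. f x * indicator {0<..} x \<partial>lborel)"
  by (subst nn_integral_density) (auto simp: mult.commute)

lemma AE_lborel_pos: "(AE x in lborel_pos. P x) \<longleftrightarrow> (AE x in lborel. 0 < x \<longrightarrow> P x)"
  by (subst AE_density) (auto simp: indicator_def)

lemma sigma_finite_lborel_pos: "sigma_finite_measure lborel_pos"
  by (subst sigma_finite_measure.sigma_finite_iff_density_finite[OF sigma_finite_lborel])
    (auto simp: indicator_def)

lemma emeasure_lborel_pos_lessThan: "emeasure lborel_pos {..<a} = ennreal a"
proof -
  have "emeasure lborel_pos {..<a} = (\<integral>\<^sup>+ x. indicator {0<..<a} x \<partial>lborel)"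
    by (subst emeasure_density)
      (auto intro!: nn_integral_cong simp: indicator_def simp del: nn_integral_indicator)
  also have "\<dots> = ennreal a"
    by (cases "a \<ge> 0") (auto simp: ennreal_neg)
  finally show ?thesis .
qed

text \<open>The open left rays form an intersection-stable generator of the Borel sets, and
  countably many of them, each of finite measure, exhaust the line. This identifies measures on the
  half-line through their distribution functions.\<close>

lemma measure_eqI_lessThan_finite:
  fixes M N :: "real measure"
  assumes sets: "sets M = sets borel" "sets N = sets borel"
    and fin: "\<And>x. emeasure M {..<x} \<noteq> \<infinity>"
    and eq: "\<And>x. emeasure M {..<x} = emeasure N {..<x}"
  shows "M = N"
proof (rule measure_eqI_generator_eq)
  let ?E = "range (\<lambda>a::real. {..<a})"
  have "{..<a} \<inter> {..<b} = {..<min a b}" for a b :: real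
    by auto
  then show "Int_stable ?E"
    by (auto simp: Int_stable_def)
  show "?E \<subseteq> Pow UNIV" "sets M = sigma_sets UNIV ?E" "sets N = sigma_sets UNIV ?E"
    unfolding sets borel_Iio by auto
  show "range (\<lambda>i. {..<real i}) \<subseteq> ?E" by auto
  show "(\<Union>i. {..<real i}) = UNIV"
    using reals_Archimedean2 by auto
qed (use fin eq in auto)

text \<open>This is the change of variables u = t^(1-p), for which |du| = (p-1) t^(-p) dt. The map
  is decreasing on the half-line, so u < a means that t exceeds a^(1/(1-p)), and the improper
  integral of the density over that ray equals a.\<close>

lemma distr_powr_lborel_pos:
  fixes p :: real
  assumes p: "p > 1"
  shows "distr (density lborel (\<lambda>t. ennreal ((p - 1) * t powr (-p)) * indicator {0<..} t)) borel
           (\<lambda>t. t powr (1 - p)) = lborel_pos" (is "distr ?D borel ?g = _")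
proof -
  have iff: "t powr (1 - p) < a \<longleftrightarrow> a powr (1 / (1 - p)) < t" if "t > 0" "a > 0" for a t :: real
  proof -
    have "t powr (1 - p) < a \<longleftrightarrow> t powr (1 - p) < (a powr (1 / (1 - p))) powr (1 - p)"
      using that p by (simp add: powr_powr)
    also have "\<dots> \<longleftrightarrow> a powr (1 / (1 - p)) < t"
      using that p powr_less_mono2_neg[of "1 - p" t "a powr (1 / (1 - p))"]
        powr_less_mono2_neg[of "1 - p" "a powr (1 / (1 - p))" t]
      by (smt (verit) powr_gt_zero)
    finally show ?thesis .
  qed
  have em: "emeasure (distr ?D borel ?g) {..<a} = ennreal a" for a
  proof -
    have "emeasure (distr ?D borel ?g) {..<a} = emeasure ?D {t. t powr (1 - p) < a}"
      by (subst emeasure_distr) (auto simp: vimage_def)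
    also have "\<dots> = (\<integral>\<^sup>+ t. ennreal ((p - 1) * t powr (-p)) * indicator {0<..} t
        * indicator {t. t powr (1 - p) < a} t \<partial>lborel)"
      by (subst emeasure_density) auto
    also have "\<dots> = ennreal a"
    proof (cases "a > 0")
      case True
      let ?c = "a powr (1 / (1 - p))"
      have c: "?c > 0" using True by simp
      \<comment> \<open>The sublevel set is the open ray starting at \<open>?c\<close>; the closed
        ray required by the fundamental theorem of calculus differs from it in a single null
        point.\<close>
      have "(\<integral>\<^sup>+ t. ennreal ((p - 1) * t powr (-p)) * indicator {0<..} t
        * indicator {t. t powr (1 - p) < a} t \<partial>lborel)
        = (\<integral>\<^sup>+ t. ennreal ((p - 1) * t powr (-p)) * indicator {?c..} t \<partial>lborel)"
        by (intro nn_integral_cong_AE eventually_mono[OF AE_lborel_singleton[of ?c]])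
          (use c iff[OF _ True] less_le_trans[OF c] in \<open>auto simp: indicator_def\<close>)
      also have "\<dots> = ennreal (0 - (- (?c powr (1 - p))))"
      proof (rule nn_integral_FTC_atLeast)
        show "((\<lambda>x. - (x powr (1 - p))) has_real_derivative (p - 1) * x powr - p) (at x)"
          if "?c \<le> x" for x
        proof -
          have "x > 0" using c that by linarith
          then show ?thesis by (auto intro!: derivative_eq_intros simp: algebra_simps)
        qed
        show "((\<lambda>x. - (x powr (1 - p))) \<longlongrightarrow> 0) at_top"
          using tendsto_minus[OF tendsto_neg_powr[OF _ filterlim_ident, of "1 - p"]] p by simp
      qed (use p in auto)
      also have "\<dots> = ennreal a"
        using True p by (simp add: powr_powr)
      finally show ?thesis .
    next
      case False
      have *: "\<not> t powr (1 - p) < a" for t :: real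
        using False by (smt (verit) powr_ge_zero)
      show ?thesis using False by (simp add: * ennreal_neg)
    qed
    finally show ?thesis .
  qed
  show ?thesis
    by (rule measure_eqI_lessThan_finite)
       (auto simp: em emeasure_lborel_pos_lessThan)
qed

lemma nn_integral_powr_substitution:
  fixes p :: real and h :: "real \<Rightarrow> ennreal"
  assumes p: "p > 1" and [measurable]: "h \<in> borel_measurable borel"
  shows "(\<integral>\<^sup>+ t. ennreal ((p - 1) * t powr (-p)) * h t \<partial>lborel_pos)
    = (\<integral>\<^sup>+ u. h (u powr (1 / (1 - p))) \<partial>lborel_pos)"
proof -
  have "(\<integral>\<^sup>+ u. h (u powr (1 / (1 - p))) \<partial>lborel_pos)
    = (\<integral>\<^sup>+ t. h ((t powr (1 - p)) powr (1 / (1 - p)))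
        \<partial>density lborel (\<lambda>t. ennreal ((p - 1) * t powr (-p)) * indicator {0<..} t))"
    by (subst distr_powr_lborel_pos[OF p, symmetric], subst nn_integral_distr) auto
  also have "\<dots> = (\<integral>\<^sup>+ t. ennreal ((p - 1) * t powr (-p)) * h t \<partial>lborel_pos)"
    by (subst nn_integral_density, simp, simp, subst nn_integral_lborel_pos, simp)
      (use p in \<open>auto intro!: nn_integral_cong simp: indicator_def powr_powr ac_simps\<close>)
  finally show ?thesis ..
qed

section \<open>Polar coordinates with radial variable |x|^n\<close>

text \<open>The measure whose completion is \<open>surface_measure\<close>. Product measures and
  Fubini are handled with this Borel version; almost-everywhere statements and nonnegative integrals
  transfer to the completion unchanged.\<close>

definition cone_measure :: "'a::euclidean_space measure" where
  "cone_measure = distr (scale_measure (of_nat DIM('a)) (restrict_space lborel (ball 0 1 - {0})))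
            (restrict_space borel (sphere 0 1)) (\<lambda>x. x /\<^sub>R norm x)"

lemma surface_measure_eq_completion: "surface_measure = completion cone_measure"
  by (simp add: surface_measure_def cone_measure_def)

lemma space_cone_measure [simp]: "space cone_measure = sphere 0 1"
  by (simp add: cone_measure_def)

lemma sets_cone_measure [measurable_cong]:
  "sets cone_measure = sets (restrict_space borel (sphere 0 1))"
  by (simp add: cone_measure_def)

lemma sets_cone_measure_iff:
  "E \<in> sets (cone_measure :: 'a::euclidean_space measure) \<longleftrightarrow> E \<in> sets borel \<and> E \<subseteq> sphere 0 1"
  by (auto simp: sets_cone_measure sets_restrict_space_iff)

lemma emeasure_cone_measure:
  fixes E :: "'a::euclidean_space set"
  assumes "E \<in> sets cone_measure"
  shows "emeasure cone_measure E =
    of_nat DIM('a) * emeasure lborel {x \<in> ball 0 1 - {0}. x /\<^sub>R norm x \<in> E}"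
  using assms emeasure_surface_measure[of E]
  by (simp add: surface_measure_eq_completion sets_cone_measure_iff)

lemma finite_cone_measure: "finite_measure (cone_measure :: 'a::euclidean_space measure)"
proof
  have "emeasure (cone_measure :: 'a measure) (sphere 0 1)
      \<le> of_nat DIM('a) * emeasure lborel (ball 0 1 :: 'a set)"
    by (subst emeasure_cone_measure)
       (auto simp: sets_cone_measure_iff intro!: mult_left_mono emeasure_mono)
  also have "\<dots> < \<infinity>"
    using emeasure_lborel_ball_finite[of "0::'a" 1]
    by (auto simp: ennreal_mult_less_top of_nat_less_top)
  finally show "emeasure (cone_measure :: 'a measure) (space cone_measure) \<noteq> \<infinity>"
    by simp
qed

text \<open>The truncated cone on the left is the image of the unit cone over \<open>E\<close> under
  dilation by a^(1/n), which multiplies Lebesgue measure by a. For a not positive both sides vanish.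
  Measuring the radius by |x|^n is what makes the result linear in a.\<close>

lemma emeasure_cone_scale:
  fixes E :: "'a::euclidean_space set"
  assumes E: "E \<in> sets cone_measure"
  shows "of_nat DIM('a) * emeasure lborel {x. x \<noteq> 0 \<and> norm x ^ DIM('a) < a \<and> x /\<^sub>R norm x \<in> E}
    = ennreal a * emeasure cone_measure E"
proof (cases "a > 0")
  case True
  let ?n = "DIM('a)"
  define b where "b = a powr (1 / real ?n)"
  have b: "b > 0" "b ^ ?n = a"
    using True by (simp_all add: b_def powr_powr flip: powr_realpow)
  let ?C = "{x \<in> ball 0 1 - {0}. x /\<^sub>R norm x \<in> E}"
  have [measurable]: "E \<in> sets borel" using E by (simp add: sets_cone_measure_iff)
  have C: "?C \<in> sets borel" by measurable
  have less: "norm x ^ ?n < a \<longleftrightarrow> norm x < b" for x :: 'a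
    using power_mono_iff[of b "norm x" ?n] b by (auto simp flip: not_le)
  have "{x. x \<noteq> 0 \<and> norm x ^ ?n < a \<and> x /\<^sub>R norm x \<in> E} = (\<lambda>x. b *\<^sub>R x + 0) ` ?C" (is "?D = _")
  proof (intro equalityI subsetI)
    fix x assume "x \<in> ?D"
    then show "x \<in> (\<lambda>x. b *\<^sub>R x + 0) ` ?C"
      using b by (intro image_eqI[of _ _ "x /\<^sub>R b"]) (auto simp: less field_simps)
  qed (use b in \<open>auto simp: less field_simps\<close>)
  moreover have "?D \<in> sets borel" by measurable
  ultimately have "emeasure lborel ?D = ennreal a * emeasure lborel ?C"
    using emeasure_lebesgue_affine[of b 0 ?C] b C
    by (simp add: emeasure_completion ennreal_power[symmetric])
  then show ?thesis
    by (simp add: emeasure_cone_measure[OF E] mult.left_commute)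
next
  case False
  then have "\<not> norm x ^ DIM('a) < a" for x :: 'a
    by (smt (verit) zero_le_power norm_ge_zero)
  with False show ?thesis by (simp add: ennreal_neg)
qed

lemma measurable_polar:
  "(\<lambda>x. (norm x ^ DIM('a), x /\<^sub>R norm x)) \<in>
    measurable (restrict_space lborel (- {0::'a::euclidean_space})) (borel \<Otimes>\<^sub>M cone_measure)"
proof (rule measurable_Pair)
  let ?L = "restrict_space lborel (- {0::'a})"
  show "(\<lambda>x. norm x ^ DIM('a)) \<in> borel_measurable ?L"
    by (rule measurable_restrict_space1) measurable
  have "(\<lambda>x. x /\<^sub>R norm x) \<in> borel_measurable ?L"
    by (rule measurable_restrict_space1) measurable
  then show "(\<lambda>x. x /\<^sub>R norm x) \<in> measurable ?L cone_measure"
    unfolding measurable_cong_sets[OF refl sets_cone_measure]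
    by (rule measurable_restrict_space2[rotated]) (auto simp: space_restrict_space)
qed

text \<open>In the variable t = |x|^n the Jacobian n r^(n-1) dr becomes dt, so polar coordinates
  give a plain product measure. By uniqueness of sigma-finite product measures, rectangles
  suffice.\<close>

lemma polar_measure_eq:
  "lborel_pos \<Otimes>\<^sub>M cone_measure =
    distr (scale_measure (of_nat DIM('a)) (restrict_space lborel (- {0::'a::euclidean_space})))
      (borel \<Otimes>\<^sub>M cone_measure) (\<lambda>x. (norm x ^ DIM('a), x /\<^sub>R norm x))" (is "_ = distr ?L _ ?T")
proof (rule pair_measure_eqI)
  let ?n = "DIM('a)"
  show "sigma_finite_measure lborel_pos" by (rule sigma_finite_lborel_pos)
  show "sigma_finite_measure (cone_measure :: 'a measure)"
    using finite_cone_measure finite_measure_def by auto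
  show "sets (lborel_pos \<Otimes>\<^sub>M cone_measure) =
      sets (distr ?L (borel \<Otimes>\<^sub>M cone_measure) ?T)"
    by (simp cong: sets_pair_measure_cong)
  have T: "?T \<in> measurable ?L (borel \<Otimes>\<^sub>M cone_measure)"
    by (subst measurable_cong_sets[OF sets_scale_measure refl]) (rule measurable_polar)
  fix A :: "real set" and E :: "'a set"
  assume "A \<in> sets lborel_pos" and E: "E \<in> sets cone_measure"
  then have A: "A \<in> sets borel" by simp
  have [measurable]: "E \<in> sets borel" using E by (simp add: sets_cone_measure_iff)
  let ?K = "{x. x \<noteq> 0 \<and> x /\<^sub>R norm x \<in> E}"
  have K: "?K \<in> sets borel" by measurable
  \<comment> \<open>With \<open>E\<close> fixed, both sides of the rectangle identity become
    measures in the radial set: \<open>M\<close> is the pushed-forward volume of the cone over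
    \<open>E\<close>, and \<open>N\<close> is a multiple of \<open>lborel_pos\<close>. They agree on
    left rays by \<open>emeasure_cone_scale\<close>, hence everywhere.\<close>
  define M where "M = distr (density lborel (\<lambda>x. of_nat ?n * indicator ?K x)) borel (\<lambda>x. norm x ^ ?n)"
  define N where "N = scale_measure (emeasure cone_measure E) lborel_pos"
  have M: "emeasure M B = of_nat ?n * emeasure lborel {x \<in> ?K. norm x ^ ?n \<in> B}"
    if [measurable]: "B \<in> sets borel" for B
  proof -
    have "emeasure M B = emeasure (density lborel (\<lambda>x. of_nat ?n * indicator ?K x))
        {x. norm x ^ ?n \<in> B}"
      unfolding M_def by (subst emeasure_distr) (auto simp: vimage_def)
    also have "\<dots> = (\<integral>\<^sup>+x. of_nat ?n * indicator {x \<in> ?K. norm x ^ ?n \<in> B} x \<partial>lborel)"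
      using K by (subst emeasure_density) (auto intro!: nn_integral_cong simp: indicator_def)
    also have "\<dots> = of_nat ?n * emeasure lborel {x \<in> ?K. norm x ^ ?n \<in> B}"
      by (subst nn_integral_cmult_indicator) auto
    finally show ?thesis .
  qed
  interpret finite_measure "cone_measure :: 'a measure" by (rule finite_cone_measure)
  have "M = N"
  proof (rule measure_eqI_lessThan_finite)
    have "emeasure M {..<a} = emeasure cone_measure E * ennreal a" for a
      using emeasure_cone_scale[OF E, of a] by (simp add: M conj_ac mult.commute)
    moreover have "emeasure N {..<a} = emeasure cone_measure E * ennreal a" for a
      by (simp add: N_def emeasure_lborel_pos_lessThan)
    ultimately show "emeasure M {..<a} \<noteq> \<infinity>" "emeasure M {..<a} = emeasure N {..<a}" for a
      by (auto simp: ennreal_mult_eq_top_iff)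
  qed (auto simp: M_def N_def)
  then have "emeasure lborel_pos A * emeasure cone_measure E = emeasure M A"
    by (simp add: N_def mult.commute)
  also have "\<dots> = emeasure ?L {x \<in> ?K. norm x ^ ?n \<in> A}"
    unfolding M[OF A] emeasure_scale_measure by (subst emeasure_restrict_space) auto
  also have "\<dots> = emeasure (distr ?L (borel \<Otimes>\<^sub>M cone_measure) ?T) (A \<times> E)"
  proof -
    have "?T -` (A \<times> E) \<inter> space ?L = {x \<in> ?K. norm x ^ ?n \<in> A}"
      by (auto simp: space_scale_measure space_restrict_space)
    then show ?thesis
      using A E by (subst emeasure_distr[OF T]) auto
  qed
  finally show "emeasure lborel_pos A * emeasure cone_measure E =
    emeasure (distr ?L (borel \<Otimes>\<^sub>M cone_measure) ?T) (A \<times> E)" .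
qed

lemma pair_sigma_finite_polar:
  "pair_sigma_finite lborel_pos (cone_measure :: 'a::euclidean_space measure)"
  using sigma_finite_lborel_pos finite_cone_measure[THEN finite_measure.axioms(1)]
  by (rule pair_sigma_finite.intro)

lemma measurable_cone_measure_borel: "(\<lambda>x. x) \<in> borel_measurable cone_measure"
  unfolding cone_measure_def by (simp add: measurable_restrict_space1)

lemma AE_polar_pos: "AE z in lborel_pos \<Otimes>\<^sub>M (cone_measure :: 'a::euclidean_space measure). fst z > 0"
proof -
  interpret pair_sigma_finite lborel_pos "cone_measure :: 'a measure"
    by (rule pair_sigma_finite_polar)
  show ?thesis
  proof (rule AE_pair_measure)
    show "{z \<in> space (lborel_pos \<Otimes>\<^sub>M cone_measure). 0 < fst z} \<in>
      sets (lborel_pos \<Otimes>\<^sub>M (cone_measure :: 'a measure))"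
      by measurable
  qed (auto simp: AE_lborel_pos)
qed

text \<open>This is the integral form of \<open>polar_measure_eq\<close>: the point with coordinates
  (t, \<theta>) is t^(1/n) \<theta>. The origin has no polar coordinates, but it is a null
  set.\<close>

lemma nn_integral_polar:
  fixes g :: "'a::euclidean_space \<Rightarrow> ennreal"
  assumes [measurable]: "g \<in> borel_measurable borel"
  shows "of_nat DIM('a) * (\<integral>\<^sup>+ x. g x \<partial>lborel) =
    (\<integral>\<^sup>+ z. g (fst z powr (1 / DIM('a)) *\<^sub>R snd z) \<partial>(lborel_pos \<Otimes>\<^sub>M cone_measure))"
proof -
  let ?n = "DIM('a)"
  let ?L = "restrict_space lborel (- {0::'a})"
  let ?T = "\<lambda>x::'a. (norm x ^ ?n, x /\<^sub>R norm x)"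
  have T: "?T \<in> measurable (scale_measure (of_nat ?n) ?L) (borel \<Otimes>\<^sub>M cone_measure)"
    by (subst measurable_cong_sets[OF sets_scale_measure refl]) (rule measurable_polar)
  have [measurable]: "snd \<in> borel_measurable (borel \<Otimes>\<^sub>M (cone_measure :: 'a measure))"
    by (rule measurable_compose[OF measurable_snd measurable_cone_measure_borel])
  have g: "(\<lambda>z. g (fst z powr (1 / ?n) *\<^sub>R snd z)) \<in> borel_measurable (borel \<Otimes>\<^sub>M cone_measure)"
    by measurable
  have "(\<integral>\<^sup>+ z. g (fst z powr (1 / ?n) *\<^sub>R snd z) \<partial>(lborel_pos \<Otimes>\<^sub>M cone_measure))
    = (\<integral>\<^sup>+ x. g ((norm x ^ ?n) powr (1 / ?n) *\<^sub>R (x /\<^sub>R norm x)) \<partial>scale_measure (of_nat ?n) ?L)"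
    unfolding polar_measure_eq using g by (subst nn_integral_distr[OF T]) auto
  also have "\<dots> = of_nat ?n * (\<integral>\<^sup>+ x. g ((norm x ^ ?n) powr (1 / ?n) *\<^sub>R (x /\<^sub>R norm x)) \<partial>?L)"
    by (rule nn_integral_scale_measure) (intro measurable_restrict_space1, measurable)
  also have "(\<integral>\<^sup>+ x. g ((norm x ^ ?n) powr (1 / ?n) *\<^sub>R (x /\<^sub>R norm x)) \<partial>?L) = (\<integral>\<^sup>+ x. g x \<partial>?L)"
    by (intro nn_integral_cong)
      (auto simp: space_restrict_space powr_powr simp flip: powr_realpow)
  also have "\<dots> = (\<integral>\<^sup>+ x. g x \<partial>lborel)"
    by (subst nn_integral_restrict_space)
      (auto intro!: nn_integral_cong_AE eventually_mono[OF AE_lborel_singleton[of 0]])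
  finally show ?thesis ..
qed

declare measurable_cone_measure_borel [measurable]

text \<open>For t = |x|^n the weight becomes (p-1) t^(-p), which the substitution u = t^(1-p)
  absorbs on each ray. The radius t^(1/n) turns into u^(1/(n(1-p))), so all dependence on p moves
  from the measure into the integrand.\<close>

lemma nn_integral_weighted_polar:
  fixes g :: "'a::euclidean_space \<Rightarrow> ennreal" and p :: real
  assumes p: "p > 1" and [measurable]: "g \<in> borel_measurable borel"
  shows "of_nat DIM('a) * (\<integral>\<^sup>+ x. ennreal ((p - 1) * norm x powr (- (DIM('a) * p))) * g x \<partial>lborel) =
    (\<integral>\<^sup>+ z. g (fst z powr (1 / (DIM('a) * (1 - p))) *\<^sub>R snd z) \<partial>(lborel_pos \<Otimes>\<^sub>M cone_measure))"
proof -
  let ?n = "DIM('a)"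
  interpret pair_sigma_finite lborel_pos "cone_measure :: 'a measure"
    by (rule pair_sigma_finite_polar)
  have "of_nat ?n * (\<integral>\<^sup>+ x. ennreal ((p - 1) * norm x powr (- (?n * p))) * g x \<partial>lborel)
    = (\<integral>\<^sup>+ z. ennreal ((p - 1) * norm (fst z powr (1 / ?n) *\<^sub>R snd z) powr (- (?n * p)))
        * g (fst z powr (1 / ?n) *\<^sub>R snd z) \<partial>(lborel_pos \<Otimes>\<^sub>M cone_measure))"
    by (rule nn_integral_polar) measurable
  also have "\<dots> = (\<integral>\<^sup>+ z. ennreal ((p - 1) * fst z powr (- p))
        * g (fst z powr (1 / ?n) *\<^sub>R snd z) \<partial>(lborel_pos \<Otimes>\<^sub>M cone_measure))"
  proof (intro nn_integral_cong_AE)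
    show "AE z in lborel_pos \<Otimes>\<^sub>M cone_measure.
      ennreal ((p - 1) * norm (fst z powr (1 / ?n) *\<^sub>R snd z) powr (- (?n * p)))
        * g (fst z powr (1 / ?n) *\<^sub>R snd z) =
      ennreal ((p - 1) * fst z powr (- p)) * g (fst z powr (1 / ?n) *\<^sub>R snd z)"
      using AE_polar_pos AE_space
      by eventually_elim (auto simp: space_pair_measure powr_powr)
  qed
  also have "\<dots> = (\<integral>\<^sup>+ \<theta>. \<integral>\<^sup>+ t. ennreal ((p - 1) * t powr (- p))
        * g (t powr (1 / ?n) *\<^sub>R \<theta>) \<partial>lborel_pos \<partial>cone_measure)"
    by (subst nn_integral_snd[symmetric]) auto
  also have "\<dots> = (\<integral>\<^sup>+ \<theta>. \<integral>\<^sup>+ u. g (u powr (1 / (?n * (1 - p))) *\<^sub>R \<theta>) \<partial>lborel_pos \<partial>cone_measure)"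
    by (rule nn_integral_cong, subst nn_integral_powr_substitution[OF p])
      (auto simp: powr_powr mult.commute)
  also have "\<dots> = (\<integral>\<^sup>+ z. g (fst z powr (1 / (?n * (1 - p))) *\<^sub>R snd z)
      \<partial>(lborel_pos \<Otimes>\<^sub>M cone_measure))"
    by (subst nn_integral_snd[symmetric]) auto
  finally show ?thesis .
qed

text \<open>The weighted polar formula applied to the indicator of \<open>N\<close> gives integral
  zero. It allows a function on the whole space to be replaced by an almost-everywhere equal one
  along the p-dependent radii.\<close>

lemma AE_polar_null_sets:
  fixes N :: "'a::euclidean_space set" and p :: real
  assumes p: "p > 1" and N: "N \<in> null_sets lborel"
  shows "AE u in lborel_pos. AE \<theta> in cone_measure. u powr (1 / (DIM('a) * (1 - p))) *\<^sub>R \<theta> \<notin> N"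
proof -
  interpret pair_sigma_finite lborel_pos "cone_measure :: 'a measure"
    by (rule pair_sigma_finite_polar)
  have [measurable]: "N \<in> sets borel" using N by auto
  have "(\<integral>\<^sup>+ z. indicator N (fst z powr (1 / (DIM('a) * (1 - p))) *\<^sub>R snd z)
      \<partial>(lborel_pos \<Otimes>\<^sub>M cone_measure)) =
    of_nat DIM('a) * (\<integral>\<^sup>+ x. ennreal ((p - 1) * norm x powr (- (DIM('a) * p))) * indicator N x \<partial>lborel)"
    by (rule nn_integral_weighted_polar[OF p, symmetric]) measurable
  also have "(\<integral>\<^sup>+ x. ennreal ((p - 1) * norm x powr (- (DIM('a) * p))) * indicator N x \<partial>lborel) = 0"
    using AE_not_in[OF N] by (subst nn_integral_0_iff_AE) (auto elim: eventually_mono)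
  finally have "AE z in lborel_pos \<Otimes>\<^sub>M cone_measure. fst z powr (1 / (DIM('a) * (1 - p))) *\<^sub>R snd z \<notin> N"
    by (simp add: nn_integral_0_iff_AE indicator_eq_0_iff)
  from AE_pair[OF this] show ?thesis by simp
qed

section \<open>Powers, growing radii and completed measurability\<close>

lemma ennreal_powr_Lp_norm:
  assumes "p > 0"
  shows "ennreal_powr (Lp_norm p M g) p = (\<integral>\<^sup>+ x. ennreal (norm (g x) powr p) \<partial>M)"
  using assms by (auto simp: Lp_norm_def ennreal_powr_def powr_powr less_top[symmetric])

lemma in_Lp_nn_integral_finite:
  "in_Lp p M g \<Longrightarrow> (\<integral>\<^sup>+ x. ennreal (norm (g x) powr p) \<partial>M) < \<infinity>"
  by (auto simp: in_Lp_def Lp_norm_def ennreal_powr_def less_top split: if_splits)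

text \<open>Values at most 1 are covered by the constant, and larger ones by monotonicity in the
  exponent. This supplies majorants independent of p.\<close>

lemma powr_le_1_plus_powr:
  fixes x p q :: real
  assumes "0 \<le> x" "0 \<le> p" "p \<le> q"
  shows "x powr p \<le> 1 + x powr q"
proof (cases "x \<le> 1")
  case True
  then have "x powr p \<le> 1" using assms by (simp add: powr_le1)
  then show ?thesis by (smt (verit) powr_ge_zero)
next
  case False
  then have "x powr p \<le> x powr q" using assms by (intro powr_mono) auto
  then show ?thesis by simp
qed

text \<open>The logarithm of the radius is ln u, which is negative, times 1/(c(1-p)), which tends to
  minus infinity as p decreases to 1.\<close>

lemma filterlim_powr_radius:
  fixes u c :: real and p :: "nat \<Rightarrow> real"
  assumes u: "0 < u" "u < 1" and c: "c > 0" and p: "\<And>k. p k > 1" "p \<longlonglongrightarrow> 1"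
  shows "filterlim (\<lambda>k. u powr (1 / (c * (1 - p k)))) at_top sequentially"
proof -
  have "(\<lambda>k. c * (1 - p k)) \<longlonglongrightarrow> c * (1 - 1)"
    by (intro tendsto_intros p)
  then have "filterlim (\<lambda>k. inverse (c * (1 - p k))) at_bot sequentially"
    using c p(1) by (intro filterlim_inverse_at_bot) (auto simp: mult_less_0_iff)
  then have "filterlim (\<lambda>k. ln u * inverse (c * (1 - p k))) at_top sequentially"
    using u by (subst filterlim_tendsto_neg_mult_at_top_iff[OF tendsto_const]) auto
  then have "filterlim (\<lambda>k. exp (ln u * inverse (c * (1 - p k)))) at_top sequentially"
    by (rule filterlim_compose[OF exp_at_top])
  then show ?thesis
    using u by (simp add: powr_def field_simps)
qed

text \<open>Preimages under the two functions differ only inside a null set. It serves for the limit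
  function, which is specified only almost everywhere.\<close>

lemma borel_measurable_completion_AE_eq:
  fixes f g :: "'a \<Rightarrow> real"
  assumes g: "g \<in> borel_measurable M" and eq: "AE x in M. g x = f x"
  shows "f \<in> borel_measurable (completion M)"
proof (rule measurableI)
  fix B :: "real set" assume B: "B \<in> sets borel"
  show "f -` B \<inter> space (completion M) \<in> sets (completion M)"
  proof (rule completion.in_sets_AE)
    show "AE x in completion M. x \<in> g -` B \<inter> space M \<longleftrightarrow> x \<in> f -` B \<inter> space (completion M)"
      unfolding AE_completion_iff using eq by (auto elim: eventually_mono)
  qed (use measurable_sets[OF g B] in auto)
qed simp

section \<open>The contribution from outside the ball of radius \<open>R0\<close>\<close>

text \<open>Dominated convergence on one fixed product space. Working along a sequence of exponents
  leaves countably many radii for each u, so the exceptional null sets of the pointwise bound, which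
  depend on the radius, can be united.\<close>

lemma tendsto_nn_integral_outside_ball:
  fixes F G A :: "'a::euclidean_space \<Rightarrow> real" and p :: "nat \<Rightarrow> real" and R0 p0 :: real
  assumes F: "F \<in> borel_measurable lebesgue" "\<And>x. F x \<ge> 0"
    and R0: "R0 \<ge> 1"
    and bound: "\<And>r. r \<ge> R0 \<Longrightarrow> AE \<theta> in surface_measure. r ^ DIM('a) * F (r *\<^sub>R \<theta>) \<le> G \<theta>"
    and lim: "AE \<theta> in surface_measure. ((\<lambda>r. r ^ DIM('a) * F (r *\<^sub>R \<theta>)) \<longlongrightarrow> A \<theta>) at_top"
    and G: "in_Lp p0 surface_measure G"
    and p: "\<And>k. p k > 1" "\<And>k. p k < p0" "p \<longlonglongrightarrow> 1"
  shows "(\<lambda>k. \<integral>\<^sup>+ x. ennreal ((p k - 1) * F x powr p k) * indicator {x. R0 \<le> norm x} x \<partial>lebesgue)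
    \<longlonglongrightarrow> ennreal (1 / real DIM('a) * (\<integral>\<theta>. A \<theta> \<partial>surface_measure))"
proof -
  let ?n = "DIM('a)"
  let ?S = "cone_measure :: 'a measure"
  let ?P = "lborel_pos \<Otimes>\<^sub>M ?S"
  interpret S: finite_measure ?S by (rule finite_cone_measure)
  interpret pair_sigma_finite lborel_pos ?S by (rule pair_sigma_finite_polar)

  \<comment> \<open>Borel representatives are needed for joint measurability in radius and
    direction; \<open>N\<close> collects the points where \<open>F\<close> and \<open>F'\<close> may
    differ.\<close>
  obtain F' where F'[measurable]: "F' \<in> borel_measurable borel" and "AE x in lborel. F x = F' x"
    using completion_ex_borel_measurable_real[OF F(1)] by auto
  then obtain N where N: "N \<in> null_sets lborel" and FF': "\<And>x. x \<notin> N \<Longrightarrow> F x = F' x"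
    by (auto elim: AE_E3)
  obtain G' where G'[measurable]: "G' \<in> borel_measurable ?S" and GG': "AE \<theta> in ?S. G \<theta> = G' \<theta>"
    using G completion_ex_borel_measurable_real[of G ?S]
    by (auto simp: in_Lp_def surface_measure_eq_completion)
  have bound': "AE \<theta> in ?S. r ^ ?n * F (r *\<^sub>R \<theta>) \<le> G \<theta>" if "r \<ge> R0" for r
    using bound[OF that] unfolding surface_measure_eq_completion AE_completion_iff .
  have lim': "AE \<theta> in ?S. ((\<lambda>r. r ^ ?n * F (r *\<^sub>R \<theta>)) \<longlongrightarrow> A \<theta>) at_top"
    using lim unfolding surface_measure_eq_completion AE_completion_iff .

  \<comment> \<open>The function \<open>r k u\<close> is the radius belonging to u under the
    substitution for the exponent \<open>p k\<close>, and \<open>g k\<close> is the resulting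
    integrand, cut off where the radius is below \<open>R0\<close>.\<close>
  define r where "r k u = u powr (1 / (?n * (1 - p k)))" for k u
  define g where "g k u \<theta> = indicator {R0..} (r k u) * (r k u ^ ?n * \<bar>F' (r k u *\<^sub>R \<theta>)\<bar>) powr p k"
    for k u \<theta>
  have [measurable]: "r k \<in> borel_measurable borel" for k
    unfolding r_def by measurable
  have gm[measurable]: "(\<lambda>z. g k (fst z) (snd z)) \<in> borel_measurable (borel \<Otimes>\<^sub>M ?S)" for k
    unfolding g_def by measurable

  \<comment> \<open>All countably many pointwise requirements are bundled here. No joint
    measurability of \<open>good\<close> is claimed: it is used for almost every u and then almost
    every \<theta>, which matches a bound known at each fixed radius.\<close>
  define good where "good u \<theta> \<longleftrightarrow> (\<forall>k. r k u *\<^sub>R \<theta> \<notin> N) \<and>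
      (\<forall>k. r k u \<ge> R0 \<longrightarrow> r k u ^ ?n * F (r k u *\<^sub>R \<theta>) \<le> G \<theta>) \<and>
      ((\<lambda>r. r ^ ?n * F (r *\<^sub>R \<theta>)) \<longlongrightarrow> A \<theta>) at_top \<and> G \<theta> = G' \<theta>" for u \<theta>
  have "AE u in lborel_pos. \<forall>k. AE \<theta> in ?S. r k u *\<^sub>R \<theta> \<notin> N"
    unfolding r_def by (subst AE_all_countable) (intro allI AE_polar_null_sets p N)
  then have good: "AE u in lborel_pos. AE \<theta> in ?S. good u \<theta>"
  proof eventually_elim
    case (elim u)
    have "AE \<theta> in ?S. \<forall>k. r k u *\<^sub>R \<theta> \<notin> N"
      using elim by (subst AE_all_countable) auto
    moreover have "AE \<theta> in ?S. \<forall>k. r k u \<ge> R0 \<longrightarrow> r k u ^ ?n * F (r k u *\<^sub>R \<theta>) \<le> G \<theta>"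
      using bound' by (subst AE_all_countable) auto
    ultimately show ?case
      using lim' GG' unfolding good_def by eventually_elim auto
  qed

  have g_eq: "g k u \<theta> = indicator {R0..} (r k u) * (r k u ^ ?n * F (r k u *\<^sub>R \<theta>)) powr p k"
    if "good u \<theta>" for k u \<theta>
    using that FF' F(2) unfolding g_def good_def by (metis abs_of_nonneg)
  have g_bound: "g k u \<theta> \<le> 1 + \<bar>G' \<theta>\<bar> powr p0" if "good u \<theta>" for k u \<theta>
  proof (cases "r k u \<ge> R0")
    case True
    have "g k u \<theta> = (r k u ^ ?n * F (r k u *\<^sub>R \<theta>)) powr p k"
      using g_eq[OF that] True by simp
    also have "\<dots> \<le> 1 + (r k u ^ ?n * F (r k u *\<^sub>R \<theta>)) powr p0"
      using True R0 F(2) p(1,2)[of k] by (intro powr_le_1_plus_powr) (auto intro: less_imp_le order.strict_trans)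
    also have "(r k u ^ ?n * F (r k u *\<^sub>R \<theta>)) powr p0 \<le> \<bar>G' \<theta>\<bar> powr p0"
      using True that R0 F(2) p(1,2)[of 0] unfolding good_def
      by (intro powr_mono2) (auto intro: order_trans[OF _ abs_ge_self])
    finally show ?thesis by simp
  next
    case False
    then show ?thesis by (simp add: g_def add_nonneg_nonneg)
  qed
  have g_lim: "(\<lambda>k. g k u \<theta>) \<longlonglongrightarrow> A \<theta>" "A \<theta> \<ge> 0" if "good u \<theta>" "0 < u" "u < 1" for u \<theta>
  proof -
    have r: "filterlim (\<lambda>k. r k u) at_top sequentially"
      unfolding r_def using that p by (intro filterlim_powr_radius) auto
    have ev: "eventually (\<lambda>k. r k u \<ge> R0) sequentially"
      using r by (simp add: filterlim_at_top)
    have H: "(\<lambda>k. r k u ^ ?n * F (r k u *\<^sub>R \<theta>)) \<longlonglongrightarrow> A \<theta>"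
      using that r unfolding good_def by (auto intro: filterlim_compose)
    have nn: "r k u ^ ?n * F (r k u *\<^sub>R \<theta>) \<ge> 0" for k
      using F(2) by (simp add: r_def)
    show A: "A \<theta> \<ge> 0"
      using H nn by (intro LIMSEQ_le_const) auto
    \<comment> \<open>The limit may be 0, where \<open>powr\<close> needs care; nonnegative bases
      and the positive limit 1 of the exponents suffice.\<close>
    have "(\<lambda>k. (r k u ^ ?n * F (r k u *\<^sub>R \<theta>)) powr p k) \<longlonglongrightarrow> A \<theta> powr 1"
      using H p(3) nn by (intro tendsto_powr') auto
    then have "(\<lambda>k. (r k u ^ ?n * F (r k u *\<^sub>R \<theta>)) powr p k) \<longlonglongrightarrow> A \<theta>"
      using A by simp
    then show "(\<lambda>k. g k u \<theta>) \<longlonglongrightarrow> A \<theta>"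
      by (rule Lim_transform_eventually)
        (use ev in \<open>auto elim!: eventually_mono simp: g_eq[OF that(1)]\<close>)
  qed

  \<comment> \<open>Since (0,1) is not a null set, one slice u = v is good for almost every
    \<theta>. The limit along this slice gives the measurable representative \<open>A'\<close> of
    \<open>A\<close>.\<close>
  obtain v where v: "0 < v" "v < 1" "AE \<theta> in ?S. good v \<theta>"
  proof -
    have "\<exists>v. 0 < v \<and> v < 1 \<and> (AE \<theta> in ?S. good v \<theta>)"
    proof (rule ccontr)
      assume *: "\<not> ?thesis"
      have "AE x in lborel. (x::real) \<notin> {0<..<1}"
        using good unfolding AE_lborel_pos by eventually_elim (use * in auto)
      then have "{0<..<1::real} \<in> null_sets lborel"
        by (subst AE_iff_null_sets) auto
      then show False by auto
    qed
    then show ?thesis using that by blast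
  qed
  define A' where "A' \<theta> = lim (\<lambda>k. g k v \<theta>)" for \<theta>
  have "g k v \<in> borel_measurable ?S" for k
    unfolding g_def by measurable
  then have A'm[measurable]: "A' \<in> borel_measurable ?S"
    unfolding A'_def by measurable
  have AA': "AE \<theta> in ?S. A' \<theta> = A \<theta> \<and> A \<theta> \<ge> 0 \<and> A \<theta> \<le> 1 + \<bar>G' \<theta>\<bar> powr p0"
    using v(3)
  proof eventually_elim
    case (elim \<theta>)
    show ?case
      using g_lim[OF elim v(1,2)] g_bound[OF elim]
      by (auto simp: A'_def intro: limI LIMSEQ_le_const2)
  qed

  have Gfin: "(\<integral>\<^sup>+ \<theta>. ennreal (1 + \<bar>G' \<theta>\<bar> powr p0) \<partial>?S) < \<infinity>"
  proof -
    have "(\<integral>\<^sup>+ \<theta>. ennreal (\<bar>G' \<theta>\<bar> powr p0) \<partial>?S) = (\<integral>\<^sup>+ \<theta>. ennreal (norm (G \<theta>) powr p0) \<partial>?S)"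
      using GG' by (intro nn_integral_cong_AE) (auto elim: eventually_mono)
    also have "\<dots> < \<infinity>"
      using in_Lp_nn_integral_finite[OF G]
      by (simp add: surface_measure_eq_completion nn_integral_completion)
    finally show ?thesis
      using S.finite_emeasure_space
      by (subst ennreal_plus) (auto simp: nn_integral_add less_top[symmetric] simp del: space_cone_measure)
  qed
  have unit: "(\<integral>\<^sup>+ z. indicator {0<..1} (fst z) * ennreal (h (snd z)) \<partial>?P) = (\<integral>\<^sup>+ \<theta>. ennreal (h \<theta>) \<partial>?S)"
    if [measurable]: "h \<in> borel_measurable ?S" for h
  proof -
    have 1: "(\<integral>\<^sup>+ u. indicator {0<..1} u \<partial>lborel_pos) = 1"
      by (subst nn_integral_lborel_pos)
        (auto simp: indicator_inter_arith[symmetric] Int_absorb1 Int_absorb2 subset_iff)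
    have "(\<integral>\<^sup>+ z. indicator {0<..1} (fst z) * ennreal (h (snd z)) \<partial>?P)
      = (\<integral>\<^sup>+ \<theta>. \<integral>\<^sup>+ u. indicator {0<..1} u * ennreal (h \<theta>) \<partial>lborel_pos \<partial>?S)"
      by (subst nn_integral_snd[symmetric]) auto
    also have "\<dots> = (\<integral>\<^sup>+ \<theta>. ennreal (h \<theta>) \<partial>?S)"
      by (rule nn_integral_cong, subst nn_integral_multc) (auto simp: 1)
    finally show ?thesis .
  qed

  \<comment> \<open>For u > 1 the negative exponent makes the radius smaller than 1, hence smaller
    than \<open>R0\<close>. The integrands therefore live on u in (0,1], where the majorant has
    finite integral.\<close>
  have g0: "g k u \<theta> = 0" if "u > 1" for k u \<theta>
  proof -
    have "r k u < 1"
      unfolding r_def using that p(1)[of k] by (intro powr_less_one) (auto simp: divide_less_0_iff mult_less_0_iff)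
    then show ?thesis using R0 by (simp add: g_def)
  qed
  have DCT: "(\<lambda>k. \<integral>\<^sup>+ z. ennreal (g k (fst z) (snd z)) \<partial>?P)
      \<longlonglongrightarrow> (\<integral>\<^sup>+ z. indicator {0<..1} (fst z) * ennreal (A' (snd z)) \<partial>?P)"
  proof (rule nn_integral_dominated_convergence)
    let ?w = "\<lambda>z. indicator {0<..1} (fst z) * ennreal (1 + \<bar>G' (snd z)\<bar> powr p0)"
    show "(\<integral>\<^sup>+ z. ?w z \<partial>?P) < \<infinity>"
      using Gfin by (subst unit) auto
    show "AE z in ?P. ennreal (g k (fst z) (snd z)) \<le> ?w z" for k
    proof (rule AE_pair_measure)
      show "{z \<in> space ?P. ennreal (g k (fst z) (snd z)) \<le> ?w z} \<in> sets ?P"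
        by measurable
      have "AE u in lborel_pos. u > 0" by (simp add: AE_lborel_pos)
      with good show "AE u in lborel_pos. AE \<theta> in ?S. ennreal (g k (fst (u, \<theta>)) (snd (u, \<theta>))) \<le> ?w (u, \<theta>)"
      proof eventually_elim
        case (elim u)
        from elim(1) show ?case
          by eventually_elim (use g_bound g0 elim(2) in \<open>auto simp: indicator_def intro!: ennreal_leI simp del: ennreal_plus\<close>)
      qed
    qed
    show "AE z in ?P. (\<lambda>k. ennreal (g k (fst z) (snd z)))
        \<longlonglongrightarrow> indicator {0<..1} (fst z) * ennreal (A' (snd z))"
    proof (rule AE_pair_measure)
      \<comment> \<open>Convergence is rewritten as equalities for the lower and upper limits, which
        are measurable functions of z.\<close>
      show "{z \<in> space ?P. (\<lambda>k. ennreal (g k (fst z) (snd z)))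
        \<longlonglongrightarrow> indicator {0<..1} (fst z) * ennreal (A' (snd z))} \<in> sets ?P"
        unfolding tendsto_iff_Liminf_eq_Limsup[OF sequentially_bot] by measurable
      have "AE u in lborel_pos. u > 0" by (simp add: AE_lborel_pos)
      \<comment> \<open>At u = 1 the radius is 1 for every k and does not tend to infinity; this
        single point is discarded.\<close>
      moreover have "AE u in lborel_pos. u \<noteq> 1"
        using AE_lborel_singleton[of "1::real"] by (auto simp: AE_lborel_pos elim: eventually_mono)
      ultimately show "AE u in lborel_pos. AE \<theta> in ?S. (\<lambda>k. ennreal (g k (fst (u, \<theta>)) (snd (u, \<theta>))))
        \<longlonglongrightarrow> indicator {0<..1} (fst (u, \<theta>)) * ennreal (A' (snd (u, \<theta>)))"
        using good
      proof eventually_elim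
        case (elim u)
        from elim(3) AA' show ?case
        proof eventually_elim
          case (elim \<theta>)
          show ?case
          proof (cases "u < 1")
            case True
            then show ?thesis
              using g_lim(1)[OF elim(1)] elim(2) \<open>u > 0\<close> by (auto intro!: tendsto_ennrealI)
          next
            case False
            then show ?thesis using g0[of u] \<open>u \<noteq> 1\<close> by simp
          qed
        qed
      qed
    qed
  qed measurable

  \<comment> \<open>Finiteness, inherited from the majorant, is essential: \<open>enn2real\<close>
    would send an infinite integral to 0.\<close>
  have A_int: "(\<integral>\<^sup>+ \<theta>. ennreal (A' \<theta>) \<partial>?S) = ennreal (\<integral>\<theta>. A \<theta> \<partial>surface_measure)"
  proof -
    have le: "(\<integral>\<^sup>+ \<theta>. ennreal (A' \<theta>) \<partial>?S) \<le> (\<integral>\<^sup>+ \<theta>. ennreal (1 + \<bar>G' \<theta>\<bar> powr p0) \<partial>?S)"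
      by (intro nn_integral_mono_AE eventually_mono[OF AA']) (auto intro!: ennreal_leI simp del: ennreal_plus)
    have eq: "(\<integral>\<^sup>+ \<theta>. ennreal (A' \<theta>) \<partial>?S) = (\<integral>\<^sup>+ \<theta>. ennreal (A \<theta>) \<partial>?S)"
      using AA' by (intro nn_integral_cong_AE) (auto elim: eventually_mono)
    have "A \<in> borel_measurable surface_measure"
      unfolding surface_measure_eq_completion
      using AA' by (intro borel_measurable_completion_AE_eq[OF A'm]) (auto elim: eventually_mono)
    moreover have "AE \<theta> in surface_measure. A \<theta> \<ge> 0"
      unfolding surface_measure_eq_completion AE_completion_iff
      using AA' by (auto elim: eventually_mono)
    ultimately have "(\<integral>\<theta>. A \<theta> \<partial>surface_measure) = enn2real (\<integral>\<^sup>+ \<theta>. ennreal (A \<theta>) \<partial>?S)"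
      by (subst integral_eq_nn_integral) (auto simp: surface_measure_eq_completion nn_integral_completion)
    then show ?thesis
      using le Gfin unfolding eq by (auto simp: less_top)
  qed

  \<comment> \<open>The weight of the polar formula is inserted through F^p = |x|^(-np) (|x|^n F)^p,
    valid because |x| is at least \<open>R0\<close> and so positive on the domain.\<close>
  have polar: "of_nat ?n * (\<integral>\<^sup>+ x. ennreal ((p k - 1) * F x powr p k) * indicator {x. R0 \<le> norm x} x \<partial>lebesgue)
      = (\<integral>\<^sup>+ z. ennreal (g k (fst z) (snd z)) \<partial>?P)" for k
  proof -
    let ?h = "\<lambda>x. ennreal (indicator {R0..} (norm x) * (norm x ^ ?n * \<bar>F' x\<bar>) powr p k)"
    have "(\<integral>\<^sup>+ x. ennreal ((p k - 1) * F x powr p k) * indicator {x. R0 \<le> norm x} x \<partial>lebesgue)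
      = (\<integral>\<^sup>+ x. ennreal ((p k - 1) * norm x powr (- (?n * p k))) * ?h x \<partial>lborel)"
      unfolding nn_integral_completion
    proof (intro nn_integral_cong_AE eventually_mono[OF AE_not_in[OF N]])
      fix x assume x: "x \<notin> N"
      have "norm x powr - (?n * p k) * (norm x ^ ?n * \<bar>F' x\<bar>) powr p k = F x powr p k" if "norm x \<ge> R0"
      proof -
        have "norm x > 0" using that R0 by linarith
        then have "(norm x ^ ?n * \<bar>F' x\<bar>) powr p k = norm x powr (?n * p k) * F x powr p k"
          using FF'[OF x] F(2)[of x] by (simp add: powr_mult powr_powr flip: powr_realpow)
        with \<open>norm x > 0\<close> show ?thesis
          by (simp add: powr_minus)
      qed
      then show "ennreal ((p k - 1) * F x powr p k) * indicator {x. R0 \<le> norm x} x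
        = ennreal ((p k - 1) * norm x powr - (?n * p k)) * ?h x"
        using p(1)[of k] by (auto simp: indicator_def mult.assoc simp flip: ennreal_mult)
    qed
    then have "of_nat ?n * (\<integral>\<^sup>+ x. ennreal ((p k - 1) * F x powr p k) * indicator {x. R0 \<le> norm x} x \<partial>lebesgue)
      = (\<integral>\<^sup>+ z. ?h (r k (fst z) *\<^sub>R snd z) \<partial>?P)"
      using nn_integral_weighted_polar[OF p(1)[of k], of ?h] by (simp add: r_def)
    also have "\<dots> = (\<integral>\<^sup>+ z. ennreal (g k (fst z) (snd z)) \<partial>?P)"
      by (intro nn_integral_cong) (auto simp: space_pair_measure g_def r_def)
    finally show ?thesis .
  qed
  have "(\<lambda>k. ennreal (1 / ?n) * (of_nat ?n *
      (\<integral>\<^sup>+ x. ennreal ((p k - 1) * F x powr p k) * indicator {x. R0 \<le> norm x} x \<partial>lebesgue)))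
    \<longlonglongrightarrow> ennreal (1 / ?n) * ennreal (\<integral>\<theta>. A \<theta> \<partial>surface_measure)"
    using DCT unfolding polar unit[OF A'm] A_int by (intro ennreal_tendsto_cmult) auto
  moreover have "ennreal (1 / ?n) * (of_nat ?n * x) = x" for x
  proof -
    have "ennreal (1 / ?n) * of_nat ?n = 1"
      by (simp add: ennreal_of_nat_eq_real_of_nat flip: ennreal_mult)
    then show ?thesis by (simp add: mult.assoc[symmetric])
  qed
  ultimately show ?thesis
    by (simp add: ennreal_mult'[symmetric])
qed

section \<open>The contribution from a set of finite measure\<close>

text \<open>By F^p \<le> 1 + F^p0 the integrals over \<open>B\<close> are bounded by one finite
  constant \<open>C\<close>, so the factor p - 1 forces the limit 0.\<close>

lemma tendsto_nn_integral_inside_ball: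
  fixes F :: "'a \<Rightarrow> real" and p :: "nat \<Rightarrow> real"
  assumes F: "\<And>x. F x \<ge> 0" "F \<in> borel_measurable M"
    and B: "B \<in> sets M" "emeasure M B < \<infinity>"
    and fin: "(\<integral>\<^sup>+ x. ennreal (F x powr p0) * indicator B x \<partial>M) < \<infinity>"
    and p: "\<And>k. p k > 1" "\<And>k. p k < p0" "p \<longlonglongrightarrow> 1"
  shows "(\<lambda>k. \<integral>\<^sup>+ x. ennreal ((p k - 1) * F x powr p k) * indicator B x \<partial>M) \<longlonglongrightarrow> 0"
proof -
  define C where "C = (\<integral>\<^sup>+ x. ennreal (1 + F x powr p0) * indicator B x \<partial>M)"
  have "C = (\<integral>\<^sup>+ x. indicator B x + ennreal (F x powr p0) * indicator B x \<partial>M)"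
    unfolding C_def by (intro nn_integral_cong) (auto simp: indicator_def)
  also have "\<dots> = emeasure M B + (\<integral>\<^sup>+ x. ennreal (F x powr p0) * indicator B x \<partial>M)"
    using F B by (subst nn_integral_add) auto
  finally have "C < \<infinity>" using B fin by simp
  have "(\<lambda>k. ennreal (p k - 1)) \<longlonglongrightarrow> ennreal (1 - 1)"
    by (intro tendsto_intros p)
  then have lim: "(\<lambda>k. C * ennreal (p k - 1)) \<longlonglongrightarrow> C * 0"
    using \<open>C < \<infinity>\<close> by (intro ennreal_tendsto_cmult) auto
  have le: "(\<integral>\<^sup>+ x. ennreal ((p k - 1) * F x powr p k) * indicator B x \<partial>M) \<le> C * ennreal (p k - 1)" for k
  proof -
    have "(\<integral>\<^sup>+ x. ennreal ((p k - 1) * F x powr p k) * indicator B x \<partial>M)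
      \<le> (\<integral>\<^sup>+ x. (ennreal (1 + F x powr p0) * indicator B x) * ennreal (p k - 1) \<partial>M)"
    proof (intro nn_integral_mono)
      fix x
      have "(p k - 1) * F x powr p k \<le> (1 + F x powr p0) * (p k - 1)"
        using powr_le_1_plus_powr[OF F(1), of "p k" p0 x] p(1,2)[of k] by (simp add: mult.commute)
      then show "ennreal ((p k - 1) * F x powr p k) * indicator B x
        \<le> (ennreal (1 + F x powr p0) * indicator B x) * ennreal (p k - 1)"
        using p(1)[of k]
        by (auto simp: indicator_def intro!: ennreal_leI simp del: ennreal_plus simp flip: ennreal_mult'')
    qed
    also have "\<dots> = C * ennreal (p k - 1)"
      unfolding C_def using F B by (intro nn_integral_multc) auto
    finally show ?thesis .
  qed
  show ?thesis
    by (rule tendsto_sandwich[OF _ _ tendsto_const lim[simplified]]) (use le in auto)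
qed

section \<open>Adding the contributions from inside and outside the ball of radius
  \<open>R0\<close>\<close>

theorem theorem1p8:
  fixes T :: "('d \<Rightarrow> 'c) \<Rightarrow> (real ^ 'n \<Rightarrow> complex)"
    and f :: "'d \<Rightarrow> 'c"
    and G A :: "real ^ 'n \<Rightarrow> real"
    and R0 p0 :: real
  assumes measurable: "T f \<in> borel_measurable lebesgue"
    and R0: "R0 \<ge> 1"
    and G_L1: "integrable surface_measure G"
    and bound: "\<And>r. r \<ge> R0 \<Longrightarrow>
          AE \<theta> in surface_measure. r ^ CARD('n) * norm (T f (r *\<^sub>R \<theta>)) \<le> G \<theta>"
    and A_limit: "AE \<theta> in surface_measure.
          ((\<lambda>r. r ^ CARD('n) * norm (T f (r *\<^sub>R \<theta>))) \<longlongrightarrow> A \<theta>) at_top"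
    and p0: "p0 > 1"
    and ball_Lp: "in_Lp p0 (lebesgue_on (ball 0 1)) (T f)"
    and annulus_Lp: "in_Lp p0 (lebesgue_on (ball 0 R0 - ball 0 1)) (T f)"
    and G_Lp: "in_Lp p0 surface_measure G"
    and uniform_limit: "((\<lambda>R. SUP r\<in>{R..}. Lp_norm p0 surface_measure
            (\<lambda>\<theta>. r ^ CARD('n) * norm (T f (r *\<^sub>R \<theta>)) - A \<theta>)) \<longlongrightarrow> 0) at_top"
  shows "((\<lambda>p. ennreal (p - 1) * ennreal_powr (Lp_norm p lebesgue (T f)) p)
           \<longlongrightarrow> ennreal (1 / real CARD('n) * (\<integral>\<theta>. A \<theta> \<partial>surface_measure))) (at_right 1)"
proof (rule tendsto_at_right_sequentially[OF p0])
  \<comment> \<open>The one-sided limit is tested on sequences of exponents in (1, p0) that converge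
    to 1.\<close>
  fix p :: "nat \<Rightarrow> real"
  assume p: "\<And>k. 1 < p k" "\<And>k. p k < p0" "p \<longlonglongrightarrow> 1"
  let ?F = "\<lambda>x. norm (T f x)"
  have F: "?F \<in> borel_measurable lebesgue"
    using measurable by measurable
  \<comment> \<open>The ball of radius \<open>R0\<close> is split into the unit ball and the
    remaining annulus, and \<open>ball_Lp\<close> and \<open>annulus_Lp\<close> bound one piece
    each.\<close>
  have "(\<integral>\<^sup>+ x. ennreal (?F x powr p0) * indicator (ball 0 R0) x \<partial>lebesgue)
    = (\<integral>\<^sup>+ x. ennreal (?F x powr p0) * indicator (ball 0 1) x
        + ennreal (?F x powr p0) * indicator (ball 0 R0 - ball 0 1) x \<partial>lebesgue)"
    using R0 by (intro nn_integral_cong) (auto simp: indicator_def)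
  also have "\<dots> = (\<integral>\<^sup>+ x. ennreal (?F x powr p0) \<partial>lebesgue_on (ball 0 1))
      + (\<integral>\<^sup>+ x. ennreal (?F x powr p0) \<partial>lebesgue_on (ball 0 R0 - ball 0 1))"
  proof -
    note F [measurable]
    have [measurable]: "ball 0 1 \<in> sets (lebesgue :: (real ^ 'n) measure)"
      "ball 0 R0 - ball 0 1 \<in> sets (lebesgue :: (real ^ 'n) measure)"
      by auto
    show ?thesis
      by (subst nn_integral_add, measurable) (auto simp: nn_integral_restrict_space)
  qed
  also have "\<dots> < \<infinity>"
    using in_Lp_nn_integral_finite[OF ball_Lp] in_Lp_nn_integral_finite[OF annulus_Lp] by simp
  finally have "(\<lambda>k. \<integral>\<^sup>+ x. ennreal ((p k - 1) * ?F x powr p k) * indicator (ball 0 R0) x \<partial>lebesgue) \<longlonglongrightarrow> 0"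
    using F p emeasure_lborel_ball_finite[of "0::real^'n" R0]
    by (intro tendsto_nn_integral_inside_ball[where ?p0.0 = p0]) (auto simp: less_top)
  moreover have "(\<lambda>k. \<integral>\<^sup>+ x. ennreal ((p k - 1) * ?F x powr p k) * indicator {x. R0 \<le> norm x} x \<partial>lebesgue)
      \<longlonglongrightarrow> ennreal (1 / real CARD('n) * (\<integral>\<theta>. A \<theta> \<partial>surface_measure))"
    using tendsto_nn_integral_outside_ball[where F = ?F and G = G and A = A and p = p] F R0 bound A_limit G_Lp p by simp
  ultimately have lim: "(\<lambda>k. (\<integral>\<^sup>+ x. ennreal ((p k - 1) * ?F x powr p k) * indicator (ball 0 R0) x \<partial>lebesgue)
      + (\<integral>\<^sup>+ x. ennreal ((p k - 1) * ?F x powr p k) * indicator {x. R0 \<le> norm x} x \<partial>lebesgue))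
    \<longlonglongrightarrow> 0 + ennreal (1 / real CARD('n) * (\<integral>\<theta>. A \<theta> \<partial>surface_measure))"
    by (rule tendsto_add)
  \<comment> \<open>The p-th power undoes the root in the norm. The computation stays in
    \<open>ennreal\<close>, so the identity also covers an infinite norm.\<close>
  have "ennreal (p k - 1) * ennreal_powr (Lp_norm (p k) lebesgue (T f)) (p k) =
    (\<integral>\<^sup>+ x. ennreal ((p k - 1) * ?F x powr p k) * indicator (ball 0 R0) x \<partial>lebesgue)
      + (\<integral>\<^sup>+ x. ennreal ((p k - 1) * ?F x powr p k) * indicator {x. R0 \<le> norm x} x \<partial>lebesgue)" for k
  proof -
    have "ennreal (p k - 1) * ennreal_powr (Lp_norm (p k) lebesgue (T f)) (p k)
      = ennreal (p k - 1) * (\<integral>\<^sup>+ x. ennreal (?F x powr p k) \<partial>lebesgue)"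
      using p(1)[of k] by (simp add: ennreal_powr_Lp_norm)
    also have "\<dots> = (\<integral>\<^sup>+ x. ennreal ((p k - 1) * ?F x powr p k) \<partial>lebesgue)"
      using p(1)[of k] F by (subst nn_integral_cmult[symmetric]) (auto simp: ennreal_mult)
    also have "\<dots> = (\<integral>\<^sup>+ x. ennreal ((p k - 1) * ?F x powr p k) * indicator (ball 0 R0) x
        + ennreal ((p k - 1) * ?F x powr p k) * indicator {x. R0 \<le> norm x} x \<partial>lebesgue)"
      by (intro nn_integral_cong) (auto simp: indicator_def)
    also have "\<dots> = (\<integral>\<^sup>+ x. ennreal ((p k - 1) * ?F x powr p k) * indicator (ball 0 R0) x \<partial>lebesgue)
      + (\<integral>\<^sup>+ x. ennreal ((p k - 1) * ?F x powr p k) * indicator {x. R0 \<le> norm x} x \<partial>lebesgue)"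
    proof -
      note F [measurable]
      have "{x :: real ^ 'n. R0 \<le> norm x} \<in> sets borel"
        by measurable
      then have [measurable]: "{x. R0 \<le> norm x} \<in> sets (lebesgue :: (real ^ 'n) measure)"
        "ball 0 R0 \<in> sets (lebesgue :: (real ^ 'n) measure)"
        by auto
      show ?thesis
        by (intro nn_integral_add) measurable
    qed
    finally show ?thesis .
  qed
  with lim show "(\<lambda>k. ennreal (p k - 1) * ennreal_powr (Lp_norm (p k) lebesgue (T f)) (p k))
    \<longlonglongrightarrow> ennreal (1 / real CARD('n) * (\<integral>\<theta>. A \<theta> \<partial>surface_measure))"
    by simp
qed

end
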